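(* Let $\mathcal{G}=(\mathcal{V},\mathcal{E},w)$ be a strongly connected directed graph with positive edge weights, let $\alpha\in[0,1]$, and consider the absolute leader system on $\mathcal{G}$ with $S_0=\{s_0\}$ and $S_1=\{s_1\}$, $s_0\neq s_1$. Then $$f(S_1,\alpha)=\frac{\left|(1-\alpha)D^{\mathcal{G}}_{s_1,s_0}-\alpha D^{\mathcal{G}}_{s_0,s_1}\right|}{D^{\mathcal{G}}_{s_0,s_1}+D^{\mathcal{G}}_{s_1,s_0}} .$$
   Context: For a weighted directed graph, $A$ is the adjacency matrix ($A_{u,v}=w(u,v)$ if $(u,v)\in\mathcal{E}$, else $0$), $D$ is the diagonal out-degree matrix $D_{u,u}=\sum_v A_{u,v}$, $L=D-A$, and $W=A^\top D^{-1}$. $\pi$ is the stationary distribution ($\pi=W\pi$, $\pi>0$, $\sum_v\pi_v=1$), $\Pi=\mathrm{diag}(\pi)$, and $\mathcal{L}=\Pi(I-W^\top)$; $\dagger$ denotes the Moore–Penrose pseudoinverse. Domination score of node $u$ over node $v$: $D^{\mathcal{G}}_{u,v}=(\mathcal{L}^\dagger)_{v,v}-(\mathcal{L}^\dagger)_{v,u}$. Absolute leader system with disjoint leader sets $S_0$ (opinion $0$) and $S_1$ (opinion $1$): with $S=S_0\cup S_1$, $F=\mathcal{V}\setminus S$, the dynamics are $\dot x_S=0$, $\dot x_F=-L_{F,F}x_F-L_{F,S}x_S$, and the steady state is $\hat x_v=0$ on $S_0$, $\hat x_v=1$ on $S_1$, $\hat x_F=-(L_{F,F})^{-1}L_{F,S}\hat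 x_S$. The average opinion is $\mu(S_1)=\frac1n\sum_{v\in\mathcal{V}}\hat x_v$, $n=|\mathcal{V}|$, and $f(S_1,\alpha)=|\mu(S_1)-\alpha|$. *)

theory Defs
  imports "HOL-Analysis.Analysis"
begin

text \<open>
  A weighted directed graph has the finite type \<open>'v\<close> as its vertex set, an edge set \<open>E\<close>, and weights
  \<open>w u v\<close> that are relevant only for \<open>(u, v) \<in> E\<close>. Self-loops are not excluded.
\<close>

definition strongly_connected :: "('v \<times> 'v) set \<Rightarrow> bool" where
  "strongly_connected E \<longleftrightarrow> (\<forall>u v. (u, v) \<in> E\<^sup>*)"

definition diag :: "real ^ 'v \<Rightarrow> real ^ 'v ^ 'v" where
  "diag d = (\<chi> u v. if u = v then d $ u else 0)"

definition adjacency :: "('v::finite \<times> 'v) set \<Rightarrow> ('v \<Rightarrow> 'v \<Rightarrow> real) \<Rightarrow> real ^ 'v ^ 'v" where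
  "adjacency E w = (\<chi> u v. if (u, v) \<in> E then w u v else 0)"

definition out_degree :: "('v::finite \<times> 'v) set \<Rightarrow> ('v \<Rightarrow> 'v \<Rightarrow> real) \<Rightarrow> real ^ 'v ^ 'v" where
  "out_degree E w = diag (\<chi> u. \<Sum>v\<in>UNIV. adjacency E w $ u $ v)"

definition laplacian :: "('v::finite \<times> 'v) set \<Rightarrow> ('v \<Rightarrow> 'v \<Rightarrow> real) \<Rightarrow> real ^ 'v ^ 'v" where
  "laplacian E w = out_degree E w - adjacency E w"

definition walk_matrix :: "('v::finite \<times> 'v) set \<Rightarrow> ('v \<Rightarrow> 'v \<Rightarrow> real) \<Rightarrow> real ^ 'v ^ 'v" where
  "walk_matrix E w = transpose (adjacency E w) ** matrix_inv (out_degree E w)"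

definition is_stationary ::
    "('v::finite \<times> 'v) set \<Rightarrow> ('v \<Rightarrow> 'v \<Rightarrow> real) \<Rightarrow> real ^ 'v \<Rightarrow> bool" where
  "is_stationary E w p \<longleftrightarrow>
     p = walk_matrix E w *v p \<and> (\<forall>v. 0 < p $ v) \<and> (\<Sum>v\<in>UNIV. p $ v) = 1"

definition stationary :: "('v::finite \<times> 'v) set \<Rightarrow> ('v \<Rightarrow> 'v \<Rightarrow> real) \<Rightarrow> real ^ 'v" where
  "stationary E w = (THE p. is_stationary E w p)"

definition walk_laplacian ::
    "('v::finite \<times> 'v) set \<Rightarrow> ('v \<Rightarrow> 'v \<Rightarrow> real) \<Rightarrow> real ^ 'v ^ 'v" where
  "walk_laplacian E w = diag (stationary E w) ** (mat 1 - transpose (walk_matrix E w))"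


definition is_pinv :: "real ^ 'n ^ 'm \<Rightarrow> real ^ 'm ^ 'n \<Rightarrow> bool" where
  "is_pinv M X \<longleftrightarrow>
     M ** X ** M = M \<and> X ** M ** X = X \<and>
     transpose (M ** X) = M ** X \<and> transpose (X ** M) = X ** M"

definition pinv :: "real ^ 'n ^ 'm \<Rightarrow> real ^ 'm ^ 'n" where
  "pinv M = (THE X. is_pinv M X)"

lemma is_pinv_unique:
  assumes "is_pinv M X" and "is_pinv M Y"
  shows "X = Y"
proof -
  note X = assms(1)[unfolded is_pinv_def] and Y = assms(2)[unfolded is_pinv_def]
  have "M ** X = (M ** Y ** M) ** X" using Y by simp
  also have "\<dots> = (M ** Y) ** (M ** X)" by (simp only: matrix_mul_assoc)
  also have "\<dots> = transpose (M ** Y) ** transpose (M ** X)" using X Y by simp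
  also have "\<dots> = transpose ((M ** X) ** (M ** Y))" by (simp only: matrix_transpose_mul)
  also have "(M ** X) ** (M ** Y) = (M ** X ** M) ** Y" by (simp only: matrix_mul_assoc)
  finally have MX: "M ** X = M ** Y" using X Y by simp
  have "X ** M = X ** (M ** Y ** M)" using Y by simp
  also have "\<dots> = (X ** M) ** (Y ** M)" by (simp only: matrix_mul_assoc)
  also have "\<dots> = transpose (X ** M) ** transpose (Y ** M)" using X Y by simp
  also have "\<dots> = transpose ((Y ** M) ** (X ** M))" by (simp only: matrix_transpose_mul)
  also have "(Y ** M) ** (X ** M) = Y ** (M ** X ** M)" by (simp only: matrix_mul_assoc)
  finally have XM: "X ** M = Y ** M" using X Y by simp
  have "X = (X ** M) ** X" using X by simp
  also have "\<dots> = Y ** (M ** X)" by (simp only: XM matrix_mul_assoc)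
  also have "\<dots> = (Y ** M) ** Y" by (simp only: MX matrix_mul_assoc)
  also have "\<dots> = Y" using Y by simp
  finally show ?thesis .
qed

definition domination ::
    "('v::finite \<times> 'v) set \<Rightarrow> ('v \<Rightarrow> 'v \<Rightarrow> real) \<Rightarrow> 'v \<Rightarrow> 'v \<Rightarrow> real" where
  "domination E w u v =
     pinv (walk_laplacian E w) $ v $ v - pinv (walk_laplacian E w) $ v $ u"


text \<open>
  The submatrix of \<open>M\<close> with rows \<open>I\<close> and columns \<open>J\<close> is represented by its zero-padded extension to
  the full index type; products and sums of submatrices then become products and sums of the padded
  matrices. Accordingly, the identity of the \<open>F \<times> F\<close> matrices is \<open>block F F (mat 1)\<close>, and the inverse
  of an \<open>F \<times> F\<close> matrix is an inverse with respect to this identity among the \<open>F \<times> F\<close> matrices.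
\<close>

definition block :: "'v set \<Rightarrow> 'v set \<Rightarrow> real ^ 'v ^ 'v \<Rightarrow> real ^ 'v ^ 'v" where
  "block I J M = (\<chi> i j. if i \<in> I \<and> j \<in> J then M $ i $ j else 0)"

definition is_block_inv :: "'v::finite set \<Rightarrow> real ^ 'v ^ 'v \<Rightarrow> real ^ 'v ^ 'v \<Rightarrow> bool" where
  "is_block_inv F M X \<longleftrightarrow>
     block F F X = X \<and>
     block F F M ** X = block F F (mat 1) \<and> X ** block F F M = block F F (mat 1)"

definition block_inv :: "'v::finite set \<Rightarrow> real ^ 'v ^ 'v \<Rightarrow> real ^ 'v ^ 'v" where
  "block_inv F M = (THE X. is_block_inv F M X)"

lemma block_id_mult:
  assumes "block F F X = X"
  shows "block F F (mat 1) ** X = X" and "X ** block F F (mat 1) = X"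
proof -
  have *: "X $ i $ j = (if i \<in> F \<and> j \<in> F then X $ i $ j else 0)" for i j
    using arg_cong[OF assms, of "\<lambda>M. M $ i $ j"] by (simp add: block_def)
  have "(\<Sum>k\<in>UNIV. (if i \<in> F \<and> k \<in> F then if i = k then 1 else 0 else 0) * X $ k $ j)
      = (\<Sum>k\<in>UNIV. if k = i then X $ i $ j else 0)" for i j
    by (rule sum.cong) (use *[of i j] in auto)
  then show "block F F (mat 1) ** X = X"
    by (simp add: vec_eq_iff matrix_matrix_mult_def block_def mat_def cong: if_cong)
  have "(\<Sum>k\<in>UNIV. X $ i $ k * (if k \<in> F \<and> j \<in> F then if k = j then 1 else 0 else 0))
      = (\<Sum>k\<in>UNIV. if k = j then X $ i $ j else 0)" for i j
    by (rule sum.cong) (use *[of i j] in auto)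
  then show "X ** block F F (mat 1) = X"
    by (simp add: vec_eq_iff matrix_matrix_mult_def block_def mat_def cong: if_cong)
qed

lemma is_block_inv_unique:
  assumes "is_block_inv F M X" and "is_block_inv F M Y"
  shows "X = Y"
proof -
  note X = assms(1)[unfolded is_block_inv_def] and Y = assms(2)[unfolded is_block_inv_def]
  have "X = X ** (block F F M ** Y)" using X Y block_id_mult(2)[of F X] by simp
  also have "\<dots> = (X ** block F F M) ** Y" by (simp only: matrix_mul_assoc)
  also have "\<dots> = Y" using X Y block_id_mult(1)[of F Y] by simp
  finally show ?thesis .
qed


text \<open>
  Steady state of the absolute leader system with disjoint leader sets \<open>S0\<close> (opinion 0) and \<open>S1\<close>
  (opinion 1). The vector \<open>xS\<close> is the opinion vector of the leaders, padded with zeros on the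
  followers \<open>F\<close>; it is 0 on \<open>S0\<close>.
\<close>

definition steady_state ::
    "('v::finite \<times> 'v) set \<Rightarrow> ('v \<Rightarrow> 'v \<Rightarrow> real) \<Rightarrow> 'v set \<Rightarrow> 'v set \<Rightarrow> real ^ 'v" where
  "steady_state E w S0 S1 =
     (let S = S0 \<union> S1;
          F = UNIV - S;
          L = laplacian E w;
          xS = (\<chi> v. if v \<in> S1 then 1 else 0);
          xF = - (block_inv F L *v (block F S L *v xS))
      in (\<chi> v. if v \<in> F then xF $ v else xS $ v))"

definition avg_opinion ::
    "('v::finite \<times> 'v) set \<Rightarrow> ('v \<Rightarrow> 'v \<Rightarrow> real) \<Rightarrow> 'v set \<Rightarrow> 'v set \<Rightarrow> real" where
  "avg_opinion E w S0 S1 = 1 / real CARD('v) * (\<Sum>v\<in>UNIV. steady_state E w S0 S1 $ v)"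

definition opinion_gap ::
    "('v::finite \<times> 'v) set \<Rightarrow> ('v \<Rightarrow> 'v \<Rightarrow> real) \<Rightarrow> 'v set \<Rightarrow> 'v set \<Rightarrow> real \<Rightarrow> real" where
  "opinion_gap E w S0 S1 \<alpha> = \<bar>avg_opinion E w S0 S1 - \<alpha>\<bar>"

end

theory Submission
  imports Defs
begin

text \<open>
  Write \<open>M\<close> for the walk Laplacian and \<open>X\<close> for its pseudoinverse. All row and column sums of \<open>M\<close>
  vanish and its kernel consists of the constant vectors, so \<open>X ** M\<close> subtracts the mean. The steady
  state \<open>x\<close> is harmonic off the leaders and \<open>M *v x\<close> has zero sum, hence \<open>M *v x\<close> is a multiple \<open>c\<close> of
  \<open>e\<^sub>s\<^sub>1 - e\<^sub>s\<^sub>0\<close>. Applying \<open>X\<close> and reading off the entries at \<open>s0\<close> and \<open>s1\<close> gives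
  \<open>\<mu> = c D(s1, s0)\<close> and \<open>1 - \<mu> = c D(s0, s1)\<close>, and \<open>c \<ge> 0\<close> by the maximum principle.
\<close>

section \<open>Matrix identities and group inverses\<close>

lemma matrix_diff_ldistrib:
  fixes A :: "real ^ 'n::finite ^ 'm"
  shows "A ** (B - C) = A ** B - A ** C"
  by (simp add: vec_eq_iff matrix_matrix_mult_def right_diff_distrib sum_subtractf)

lemma matrix_diff_rdistrib:
  fixes A :: "real ^ 'n::finite ^ 'm"
  shows "(A - B) ** C = A ** C - B ** C"
  by (simp add: vec_eq_iff matrix_matrix_mult_def left_diff_distrib sum_subtractf)

lemma diag_mult_nth:
  fixes d :: "real ^ 'v::finite"
  shows "(diag d ** A) $ u $ v = d $ u * A $ u $ v"
  by (simp add: diag_def matrix_matrix_mult_def if_distrib[of "\<lambda>t. t * _"] cong: if_cong)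

lemma mult_diag_nth:
  fixes d :: "real ^ 'v::finite"
  shows "(A ** diag d) $ u $ v = A $ u $ v * d $ v"
  by (simp add: diag_def matrix_matrix_mult_def if_distrib[of "\<lambda>t. _ * t"] cong: if_cong)

lemma matrix_inv_diag:
  fixes d :: "real ^ 'v::finite"
  assumes "\<And>v. d $ v \<noteq> 0"
  shows "matrix_inv (diag d) = diag (\<chi> v. 1 / d $ v)"
proof -
  have "diag d ** diag (\<chi> v. 1 / d $ v) = mat 1" "diag (\<chi> v. 1 / d $ v) ** diag d = mat 1"
    unfolding vec_eq_iff diag_mult_nth using assms by (simp_all add: diag_def mat_def)
  \<comment> \<open>\<open>matrix_inv\<close> is a choice operator, so the candidate must also be
    shown to be the only two-sided inverse.\<close>
  then show ?thesis
    unfolding matrix_inv_def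
    by (intro some_equality conjI) (auto, metis matrix_mul_assoc matrix_mul_lid matrix_mul_rid)
qed

lemma block_apply:
  fixes A :: "real ^ 'v::finite ^ 'v"
  shows "(block I J A *v x) $ v = (if v \<in> I then \<Sum>u\<in>J. A $ v $ u * x $ u else 0)"
  by (auto simp: block_def matrix_vector_mult_def intro!: sum.mono_neutral_cong_right)

text \<open>The inverse is \<open>(M + Q)\<^sup>-\<^sup>1 - Q\<close>.\<close>

lemma group_inverse_exists:
  fixes M Q :: "real ^ 'n::finite ^ 'n"
  assumes MQ: "M ** Q = 0" and QM: "Q ** M = 0" and QQ: "Q ** Q = Q"
    and ker: "\<And>x. M *v x = 0 \<Longrightarrow> Q *v x = 0 \<Longrightarrow> x = 0"
  obtains X where "M ** X = mat 1 - Q" "X ** M = mat 1 - Q" "Q ** X = 0" "X ** Q = 0"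
proof -
  define N where "N = M + Q"
  have QN: "Q ** N = Q"
    using QM QQ by (simp add: N_def matrix_add_ldistrib)
  have NQ: "N ** Q = Q"
    using MQ QQ matrix_diff_rdistrib[of N Q Q] by (simp add: N_def)
  have "x = 0" if "N *v x = 0" for x
  proof -
    have "Q *v x = Q *v (N *v x)"
      by (simp add: matrix_vector_mul_assoc QN)
    then have "Q *v x = 0"
      using that by simp
    moreover from this have "M *v x = 0"
      using that by (simp add: N_def matrix_vector_mult_add_rdistrib)
    ultimately show ?thesis
      by (rule ker[rotated])
  qed
  then obtain Y where YN: "Y ** N = mat 1"
    using matrix_left_invertible_ker[of N] by auto
  then have NY: "N ** Y = mat 1"
    by (simp add: matrix_left_right_inverse)
  have QY: "Q ** Y = Q"
    by (metis QN NY matrix_mul_assoc matrix_mul_rid)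
  have YQ: "Y ** Q = Q"
    by (metis NQ YN matrix_mul_assoc matrix_mul_lid)
  have M: "M = N - Q"
    by (simp add: N_def)
  show thesis
  proof (rule that[of "Y - Q"])
    show "M ** (Y - Q) = mat 1 - Q" "(Y - Q) ** M = mat 1 - Q"
      by (simp_all add: M matrix_diff_ldistrib matrix_diff_rdistrib QN NQ NY YN QY YQ QQ)
    show "Q ** (Y - Q) = 0" "(Y - Q) ** Q = 0"
      by (simp_all add: matrix_diff_ldistrib matrix_diff_rdistrib QY YQ QQ)
  qed
qed

section \<open>Irreducible stochastic matrices: invariant vectors and the maximum principle\<close>

locale irreducible_stochastic =
  fixes E :: "('v::finite \<times> 'v) set" and P :: "real ^ 'v ^ 'v"
  assumes connected: "strongly_connected E"
    and edge_pos: "(u, v) \<in> E \<Longrightarrow> 0 < P $ u $ v"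
    and nonneg: "0 \<le> P $ u $ v"
    and row_sum: "(\<Sum>v\<in>UNIV. P $ u $ v) = 1"
begin

text \<open>The all-ones vector lies in the kernel of \<open>mat 1 - P\<close>, so the transpose is
  singular as well. The signs of the vector obtained are not yet controlled.\<close>

lemma invariant_vector_exists:
  obtains y where "y \<noteq> 0" "y v* P = y"
proof -
  have "(mat 1 - P) *v 1 = 0"
    unfolding matrix_vector_mult_diff_rdistrib
    by (simp add: vec_eq_iff) (simp add: matrix_vector_mult_def row_sum)
  moreover have "(1 :: real ^ 'v) \<noteq> 0"
    by simp
  ultimately have "\<not> invertible (mat 1 - P)"
    using matrix_left_invertible_ker[of "mat 1 - P"] by (auto simp: invertible_left_inverse)
  then have "\<not> invertible (transpose (mat 1 - P))"
    using transpose_invertible[of "transpose (mat 1 - P)"] by auto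
  then obtain y where "y \<noteq> 0" "transpose (mat 1 - P) *v y = 0"
    using matrix_left_invertible_ker[of "transpose (mat 1 - P)"]
    by (auto simp: invertible_left_inverse)
  moreover have "transpose (mat 1 - P) = mat 1 - transpose P"
    by (auto simp: vec_eq_iff transpose_def mat_def)
  ultimately show thesis
    by (intro that[of y]) (simp_all add: matrix_vector_mult_diff_rdistrib)
qed

text \<open>
  Entrywise \<open>\<bar>y\<bar> \<le> \<bar>y\<bar> P\<close> by the triangle inequality, and both sides have the same sum.
\<close>

lemma abs_invariant:
  assumes "y v* P = y"
  shows "(\<chi> v. \<bar>y $ v\<bar>) v* P = (\<chi> v. \<bar>y $ v\<bar>)"
proof -
  have y: "(\<Sum>u\<in>UNIV. P $ u $ v * y $ u) = y $ v" for v
    using arg_cong[OF assms, of "\<lambda>z. z $ v"] by (simp add: vector_matrix_mult_def mult.commute)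
  define g where "g v = (\<Sum>u\<in>UNIV. P $ u $ v * \<bar>y $ u\<bar>) - \<bar>y $ v\<bar>" for v
  have g_nonneg: "0 \<le> g v" for v
  proof -
    have "\<bar>y $ v\<bar> \<le> (\<Sum>u\<in>UNIV. \<bar>P $ u $ v * y $ u\<bar>)"
      using sum_abs[of "\<lambda>u. P $ u $ v * y $ u" UNIV] y[of v] by simp
    then show ?thesis
      by (simp add: g_def abs_mult abs_of_nonneg[OF nonneg])
  qed
  have "(\<Sum>v\<in>UNIV. \<Sum>u\<in>UNIV. P $ u $ v * \<bar>y $ u\<bar>)
      = (\<Sum>u\<in>UNIV. (\<Sum>v\<in>UNIV. P $ u $ v) * \<bar>y $ u\<bar>)"
    by (subst sum.swap) (simp add: sum_distrib_right)
  then have "(\<Sum>v\<in>UNIV. g v) = 0"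
    by (simp add: g_def sum_subtractf row_sum)
  then have "g v = 0" for v
    using g_nonneg by (simp add: sum_nonneg_eq_0_iff)
  then show ?thesis
    by (simp add: g_def vec_eq_iff vector_matrix_mult_def mult.commute)
qed

text \<open>A zero spreads backwards along edges: if \<open>y $ u' = 0\<close>, the invariance
  equation at \<open>u'\<close> is a vanishing sum of nonnegative terms, so \<open>y\<close>
  vanishes at every in-neighbour. Strong connectivity would then give \<open>y = 0\<close>.\<close>

lemma nonneg_invariant_pos:
  assumes inv: "y v* P = y" and y_nonneg: "\<And>v. 0 \<le> y $ v" and "y \<noteq> 0"
  shows "0 < y $ v"
proof (rule ccontr)
  assume "\<not> 0 < y $ v"
  then have v: "y $ v = 0"
    using y_nonneg[of v] by simp
  have y: "(\<Sum>u\<in>UNIV. P $ u $ v * y $ u) = y $ v" for v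
    using arg_cong[OF inv, of "\<lambda>z. z $ v"] by (simp add: vector_matrix_mult_def mult.commute)
  have "y $ u = 0" for u
  proof -
    have "(u, v) \<in> E\<^sup>*"
      using connected by (simp add: strongly_connected_def)
    then show ?thesis
    proof (induction rule: converse_rtrancl_induct)
      case base
      show ?case by (rule v)
    next
      case (step u u')
      have "(\<Sum>t\<in>UNIV. P $ t $ u' * y $ t) = 0"
        using y[of u'] step.IH by simp
      then have "P $ u $ u' * y $ u = 0"
        by (simp add: sum_nonneg_eq_0_iff nonneg y_nonneg)
      then show ?case
        using edge_pos[OF step.hyps(1)] by simp
    qed
  qed
  with \<open>y \<noteq> 0\<close> show False
    by (simp add: vec_eq_iff)
qed

text \<open>Twice the positive part of \<open>p - q\<close> is nonnegative and invariant, hence zero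
  or positive everywhere. Since \<open>p - q\<close> has zero sum, it cannot be positive everywhere,
  so it is nonpositive and therefore zero.\<close>

lemma stationary_unique:
  assumes p: "p v* P = p" "(\<Sum>v\<in>UNIV. p $ v) = 1"
    and q: "q v* P = q" "(\<Sum>v\<in>UNIV. q $ v) = 1"
  shows "p = q"
proof (rule ccontr)
  assume "p \<noteq> q"
  define y where "y = p - q"
  define z where "z = (\<chi> v. \<bar>y $ v\<bar>) + y"
  have lin: "(a + b) v* P = a v* P + b v* P" "(a - b) v* P = a v* P - b v* P" for a b
    by (simp_all add: vec_eq_iff vector_matrix_mult_def algebra_simps sum.distrib sum_subtractf)
  have y_inv: "y v* P = y"
    using p q by (simp add: y_def lin)
  then have z_inv: "z v* P = z"
    using abs_invariant[OF y_inv] by (simp add: z_def lin)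
  have sum_y: "(\<Sum>v\<in>UNIV. y $ v) = 0"
    using p q by (simp add: y_def sum_subtractf)
  have "0 \<le> z $ v" for v
    by (simp add: z_def)
  note z_pos = nonneg_invariant_pos[OF z_inv this]
  have "z = 0"
  proof (rule ccontr)
    assume "z \<noteq> 0"
    then have "0 < y $ v" for v
      using z_pos[of v] by (simp add: z_def split: abs_split)
    then have "0 < (\<Sum>v\<in>UNIV. y $ v)"
      by (simp add: sum_pos)
    with sum_y show False by simp
  qed
  then have neg_nonneg: "0 \<le> - y $ v" for v
    by (auto simp: z_def vec_eq_iff add_eq_0_iff dest: spec[of _ v])
  have "(\<Sum>v\<in>UNIV. - y $ v) = 0"
    using sum_y by (simp add: sum_negf)
  then have "- y $ v = 0" for v
    using neg_nonneg by (simp add: sum_nonneg_eq_0_iff)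
  then have "y = 0"
    by (simp add: vec_eq_iff)
  with \<open>p \<noteq> q\<close> show False
    by (simp add: y_def)
qed

lemma stationary_exists:
  obtains p where "p v* P = p" "\<And>v. 0 < p $ v" "(\<Sum>v\<in>UNIV. p $ v) = 1"
proof -
  obtain y where y: "y \<noteq> 0" "y v* P = y"
    by (rule invariant_vector_exists)
  define z :: "real ^ 'v" where "z = (\<chi> v. \<bar>y $ v\<bar>)"
  have z_inv: "z v* P = z"
    unfolding z_def by (rule abs_invariant[OF y(2)])
  have "z \<noteq> 0"
    using y(1) by (auto simp: z_def vec_eq_iff)
  moreover have "0 \<le> z $ v" for v
    by (simp add: z_def)
  ultimately have z_pos: "0 < z $ v" for v
    using nonneg_invariant_pos[OF z_inv] by blast
  define s where "s = (\<Sum>v\<in>UNIV. z $ v)"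
  have "0 < s"
    unfolding s_def by (simp add: sum_pos z_pos)
  show thesis
  proof (rule that[of "z /\<^sub>R s"])
    have "(z /\<^sub>R s) v* P = (z v* P) /\<^sub>R s"
      by (simp add: vec_eq_iff vector_matrix_mult_def sum_distrib_left mult_ac)
    then show "(z /\<^sub>R s) v* P = z /\<^sub>R s"
      by (simp add: z_inv)
    show "0 < (z /\<^sub>R s) $ v" for v
      using z_pos[of v] \<open>0 < s\<close> by simp
    show "(\<Sum>v\<in>UNIV. (z /\<^sub>R s) $ v) = 1"
      using \<open>0 < s\<close> by (simp add: sum_distrib_left[symmetric] s_def[symmetric])
  qed
qed

text \<open>A maximum attained off \<open>S\<close> is an average of values that do not exceed it,
  so every out-neighbour attains it too. Following a path towards \<open>S\<close> carries the
  maximum to a vertex of \<open>S\<close>.\<close>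

lemma maximum_principle:
  assumes harmonic: "\<And>v. v \<notin> S \<Longrightarrow> (P *v x) $ v = x $ v" and "S \<noteq> {}"
  obtains s where "s \<in> S" "\<And>v. x $ v \<le> x $ s"
proof -
  have "Max (range (($) x)) \<in> range (($) x)"
    by (rule Max_in) auto
  then obtain m where "Max (range (($) x)) = x $ m"
    by blast
  then have m: "x $ v \<le> x $ m" for v
    by (metis Max_ge finite finite_imageI rangeI)
  obtain s where "s \<in> S"
    using \<open>S \<noteq> {}\<close> by blast
  have "(m, s) \<in> E\<^sup>*"
    using connected by (simp add: strongly_connected_def)
  \<comment> \<open>Maximality of the start vertex is part of the induction formula, because the
    next vertex of the path inherits it.\<close>
  then have "\<forall>v. x $ v \<le> x $ m \<Longrightarrow> \<exists>s'\<in>S. \<forall>v. x $ v \<le> x $ s'"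
  proof (induction rule: converse_rtrancl_induct)
    case base
    with \<open>s \<in> S\<close> show ?case by blast
  next
    case (step u u')
    show ?case
    proof (cases "u \<in> S")
      case True
      with step.prems show ?thesis by blast
    next
      case False
      have "(\<Sum>t\<in>UNIV. P $ u $ t * (x $ u - x $ t)) = x $ u - (P *v x) $ u"
        by (simp add: right_diff_distrib sum_subtractf sum_distrib_right[symmetric] row_sum
            matrix_vector_mult_def)
      also have "\<dots> = 0"
        using harmonic[OF False] by simp
      finally have "P $ u $ u' * (x $ u - x $ u') = 0"
        using step.prems by (simp add: sum_nonneg_eq_0_iff nonneg)
      then have "x $ u' = x $ u"
        using edge_pos[OF step.hyps(1)] by simp
      with step.prems step.IH show ?thesis by simp
    qed
  qed
  with m that show thesis by blast
qed

text \<open>The maximum principle for \<open>x\<close> and \<open>- x\<close>. This uniqueness for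
  the Dirichlet problem is what makes the follower block invertible.\<close>

lemma harmonic_zero:
  assumes harmonic: "\<And>v. v \<notin> S \<Longrightarrow> (P *v x) $ v = x $ v" and "S \<noteq> {}"
    and zero: "\<And>v. v \<in> S \<Longrightarrow> x $ v = 0"
  shows "x = 0"
proof -
  have "x $ v \<le> 0" for v
    by (rule maximum_principle[OF harmonic \<open>S \<noteq> {}\<close>]) (auto dest: zero)
  moreover have "(- x) $ v \<le> 0" for v
  proof (rule maximum_principle[of S "- x"])
    show "(P *v (- x)) $ v = (- x) $ v" if "v \<notin> S" for v
      using harmonic[OF that] by (simp add: matrix_vector_mult_def sum_negf)
  qed (use \<open>S \<noteq> {}\<close> zero in force)+
  ultimately show ?thesis
    by (auto simp: vec_eq_iff intro: antisym)
qed

text \<open>Any single vertex \<open>b\<close> may serve as the boundary, so every value of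
  \<open>x\<close> is the maximum.\<close>

lemma harmonic_constant:
  assumes "P *v x = x"
  shows "x $ u = x $ v"
proof -
  have "x $ a \<le> x $ b" for a b
    by (rule maximum_principle[of "{b}" x]) (auto simp: assms)
  then show ?thesis
    by (intro antisym)
qed

end

section \<open>The random walk on the digraph and its two Laplacians\<close>

locale weighted_digraph =
  fixes E :: "('v::finite \<times> 'v) set" and w :: "'v \<Rightarrow> 'v \<Rightarrow> real"
  assumes connected: "strongly_connected E"
    and weight_pos: "(u, v) \<in> E \<Longrightarrow> 0 < w u v"
    and nontrivial: "\<exists>u v :: 'v. u \<noteq> v"
begin

definition "deg u = (\<Sum>v\<in>UNIV. adjacency E w $ u $ v)"

text \<open>The row-stochastic transition matrix \<open>D^-1 A\<close>; stationary distributions are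
  its left fixed vectors.\<close>

definition "P = transpose (walk_matrix E w)"

lemma adjacency_nonneg: "0 \<le> adjacency E w $ u $ v"
  using weight_pos by (auto simp: adjacency_def intro: less_imp_le)

text \<open>A path from \<open>u\<close> to a different vertex starts with an edge out of
  \<open>u\<close>. A single vertex without a loop would have degree 0.\<close>

lemma deg_pos: "0 < deg u"
proof -
  obtain u' where "u \<noteq> u'"
    using nontrivial by metis
  then obtain v where "(u, v) \<in> E"
    using connected unfolding strongly_connected_def by (metis converse_rtranclE)
  then show ?thesis
    unfolding deg_def
    by (intro sum_pos2[of _ v]) (auto simp: adjacency_nonneg, simp add: adjacency_def weight_pos)
qed

lemma P_nth: "P $ u $ v = adjacency E w $ u $ v / deg u"
proof -
  have "matrix_inv (out_degree E w) = diag (\<chi> v. 1 / deg v)"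
    unfolding out_degree_def
    by (subst matrix_inv_diag) (use deg_pos in \<open>auto simp: deg_def less_imp_neq[THEN not_sym]\<close>)
  then show ?thesis
    by (simp add: P_def walk_matrix_def transpose_def mult_diag_nth)
qed

sublocale irreducible_stochastic E P
proof
  show "strongly_connected E"
    by (rule connected)
  show "0 < P $ u $ v" if "(u, v) \<in> E" for u v
    using that weight_pos deg_pos by (simp add: P_nth adjacency_def)
  show "0 \<le> P $ u $ v" for u v
    using adjacency_nonneg deg_pos[of u] by (simp add: P_nth)
  show "(\<Sum>v\<in>UNIV. P $ u $ v) = 1" for u
    using deg_pos[of u] by (simp add: P_nth sum_divide_distrib[symmetric] deg_def)
qed

lemma laplacian_apply: "(laplacian E w *v x) $ v = deg v * (x $ v - (P *v x) $ v)"
proof -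
  have "laplacian E w $ v $ u * x $ u
      = (if u = v then deg v * x $ v else 0) - deg v * (P $ v $ u * x $ u)" for u
    using deg_pos[of v]
    by (simp add: laplacian_def out_degree_def diag_def P_nth deg_def[symmetric] left_diff_distrib)
  then show ?thesis
    by (simp add: matrix_vector_mult_def sum_subtractf right_diff_distrib sum_distrib_left)
qed

lemma is_stationary_stationary: "is_stationary E w (stationary E w)"
proof -
  have walk: "walk_matrix E w *v p = p v* P" for p
    by (simp add: P_def)
  obtain p where "p v* P = p" "\<And>v. 0 < p $ v" "(\<Sum>v\<in>UNIV. p $ v) = 1"
    by (rule stationary_exists) blast
  then have p: "is_stationary E w p"
    by (simp add: is_stationary_def walk)
  moreover have "q = p" if "is_stationary E w q" for q
    using that p stationary_unique[of q p] unfolding is_stationary_def walk by metis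
  ultimately show ?thesis
    unfolding stationary_def by (rule theI)
qed

lemma stationary_pos: "0 < stationary E w $ v"
  using is_stationary_stationary by (simp add: is_stationary_def)

text \<open>Both Laplacians scale the rows of \<open>mat 1 - P\<close> by positive factors, so they
  vanish at the same vertices. This links the steady state, defined by \<open>L\<close>, to the
  domination scores.\<close>

lemma walk_laplacian_apply:
  "(walk_laplacian E w *v x) $ v = stationary E w $ v * (x $ v - (P *v x) $ v)"
proof -
  have "(diag d *v z) $ v = d $ v * z $ v" for d z :: "real ^ 'v"
    by (simp add: diag_def matrix_vector_mult_def if_distrib[of "\<lambda>t. t * _"] cong: if_cong)
  then show ?thesis
    by (simp add: walk_laplacian_def P_def[symmetric] matrix_vector_mul_assoc[symmetric]
        matrix_vector_mult_diff_rdistrib del: transpose_matrix_vector)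
qed

section \<open>The pseudoinverse of the walk Laplacian\<close>

lemma walk_laplacian_row_sum: "(\<Sum>v\<in>UNIV. walk_laplacian E w $ u $ v) = 0"
  using walk_laplacian_apply[of 1 u] by (simp add: matrix_vector_mult_def row_sum)

text \<open>The sum of column \<open>v\<close> is \<open>pi_v - (pi P)_v\<close>, which is zero by
  stationarity.\<close>

lemma walk_laplacian_column_sum: "(\<Sum>u\<in>UNIV. walk_laplacian E w $ u $ v) = 0"
proof -
  have "stationary E w v* P = stationary E w"
    using is_stationary_stationary by (simp add: is_stationary_def P_def)
  then have "(\<Sum>u\<in>UNIV. stationary E w $ u * P $ u $ v) = stationary E w $ v"
    by (simp add: vec_eq_iff vector_matrix_mult_def mult.commute)
  then show ?thesis
    by (simp add: walk_laplacian_def diag_mult_nth P_def[symmetric] right_diff_distrib sum_subtractf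
        mat_def if_distrib[of "\<lambda>t. _ * t"] cong: if_cong)
qed

lemma pinv_walk_laplacian_mult:
  "(pinv (walk_laplacian E w) *v (walk_laplacian E w *v x)) $ v
    = x $ v - 1 / real CARD('v) * (\<Sum>u\<in>UNIV. x $ u)"
proof -
  let ?M = "walk_laplacian E w"
  \<comment> \<open>The orthogonal projection onto the constant vectors, which replaces each entry
    by the mean.\<close>
  define Q :: "real ^ 'v ^ 'v" where "Q = (\<chi> i j. 1 / real CARD('v))"
  have Q_apply: "(Q *v x) $ v = 1 / real CARD('v) * (\<Sum>u\<in>UNIV. x $ u)" for x v
    by (simp add: Q_def matrix_vector_mult_def sum_distrib_left)
  have Q_transpose: "transpose (mat 1 - Q) = mat 1 - Q"
    by (auto simp: vec_eq_iff transpose_def Q_def mat_def)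
  have MQ: "?M ** Q = 0"
    by (simp add: Q_def vec_eq_iff matrix_matrix_mult_def sum_divide_distrib[symmetric]
        walk_laplacian_row_sum)
  have QM: "Q ** ?M = 0"
    by (simp add: Q_def vec_eq_iff matrix_matrix_mult_def sum_divide_distrib[symmetric]
        walk_laplacian_column_sum)
  have QQ: "Q ** Q = Q"
    by (simp add: Q_def vec_eq_iff matrix_matrix_mult_def)
  have ker: "x = 0" if "?M *v x = 0" "Q *v x = 0" for x
  proof -
    have "(P *v x) $ v = x $ v" for v
      using that(1) stationary_pos[of v] walk_laplacian_apply[of x v] by simp
    then have "P *v x = x"
      by (simp add: vec_eq_iff)
    then have "x $ u = x $ v" for u v
      by (rule harmonic_constant)
    then have "(\<Sum>u\<in>UNIV. x $ u) = (\<Sum>u\<in>(UNIV :: 'v set). x $ v)" for v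
      by (intro sum.cong) auto
    moreover have "(\<Sum>u\<in>UNIV. x $ u) = 0"
      using that(2) by (simp add: vec_eq_iff Q_apply)
    ultimately show ?thesis
      by (simp add: vec_eq_iff)
  qed
  obtain X where X: "?M ** X = mat 1 - Q" "X ** ?M = mat 1 - Q" "Q ** X = 0" "X ** Q = 0"
    by (rule group_inverse_exists[OF MQ QM QQ ker]) blast+
  \<comment> \<open>Both products equal the symmetric matrix \<open>mat 1 - Q\<close>, so the group
    inverse is the Moore-Penrose inverse.\<close>
  have "is_pinv ?M X"
    unfolding is_pinv_def X Q_transpose by (simp add: matrix_diff_rdistrib QM X)
  then have "pinv ?M = X"
    unfolding pinv_def using is_pinv_unique by blast
  then show ?thesis
    by (simp add: matrix_vector_mul_assoc X matrix_vector_mult_diff_rdistrib Q_apply)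
qed

section \<open>The follower block and the steady state\<close>

lemma block_inv_laplacian:
  assumes "F \<noteq> UNIV"
  shows "is_block_inv F (laplacian E w) (block_inv F (laplacian E w))"
proof -
  let ?K = "block F F (laplacian E w)"
  \<comment> \<open>The projection onto the coordinates outside \<open>F\<close>. The padded block
    vanishes there, so its inverse within the \<open>F\<close> block is a group inverse.\<close>
  define Q :: "real ^ 'v ^ 'v" where "Q = mat 1 - block F F (mat 1)"
  have idem: "block F F (block F F A) = block F F A" for A :: "real ^ 'v ^ 'v"
    by (simp add: vec_eq_iff block_def)
  have KQ: "?K ** Q = 0" and QK: "Q ** ?K = 0" and QQ: "Q ** Q = Q"
    by (simp_all add: Q_def matrix_diff_ldistrib matrix_diff_rdistrib block_id_mult idem)
  have ker: "x = 0" if K: "?K *v x = 0" and Q: "Q *v x = 0" for x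
  proof -
    have zero: "x $ v = 0" if "v \<in> - F" for v
      using arg_cong[OF Q, of "\<lambda>z. z $ v"] that
      by (simp add: Q_def matrix_vector_mult_diff_rdistrib block_apply)
    show ?thesis
    proof (rule harmonic_zero[of "- F"])
      fix v assume "v \<notin> - F"
      then have "(laplacian E w *v x) $ v = (?K *v x) $ v"
        unfolding block_apply using zero
        by (auto simp: matrix_vector_mult_def intro!: sum.mono_neutral_right)
      then show "(P *v x) $ v = x $ v"
        using K deg_pos[of v] by (simp add: laplacian_apply)
    qed (use assms zero in auto)
  qed
  obtain X where X: "?K ** X = mat 1 - Q" "X ** ?K = mat 1 - Q" "Q ** X = 0" "X ** Q = 0"
    by (rule group_inverse_exists[OF KQ QK QQ ker]) blast+
  \<comment> \<open>\<open>Q ** X = 0\<close> and \<open>X ** Q = 0\<close> say that the identity of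
    the block fixes \<open>X\<close> from both sides, so \<open>X\<close> is supported on the
    block.\<close>
  have "X = block F F (mat 1) ** X ** block F F (mat 1)"
    using X(3,4) by (simp add: Q_def matrix_diff_ldistrib matrix_diff_rdistrib)
  moreover have "block F F (block F F (mat 1) ** X ** block F F (mat 1))
      = block F F (mat 1) ** X ** block F F (mat 1)"
    by (auto simp: vec_eq_iff block_def matrix_matrix_mult_def intro!: sum.neutral)
  ultimately have "block F F X = X"
    by simp
  then have "is_block_inv F (laplacian E w) X"
    using X(1,2) by (simp add: is_block_inv_def Q_def)
  then show ?thesis
    unfolding block_inv_def by (rule theI) (rule is_block_inv_unique[OF _ \<open>is_block_inv F _ X\<close>])
qed

lemma steady_state_leader0: "v \<in> S0 \<Longrightarrow> v \<notin> S1 \<Longrightarrow> steady_state E w S0 S1 $ v = 0"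
  by (simp add: steady_state_def Let_def)

lemma steady_state_leader1: "v \<in> S1 \<Longrightarrow> steady_state E w S0 S1 $ v = 1"
  by (simp add: steady_state_def Let_def)

text \<open>The follower formula solves \<open>L_FF x_F + L_FS x_S = 0\<close>, which is
  \<open>L x = 0\<close> on \<open>F\<close> once the columns are split into followers and leaders.
  A nonempty leader set makes the block inverse exist.\<close>

lemma steady_state_harmonic:
  assumes "S0 \<union> S1 \<noteq> {}" and v: "v \<notin> S0 \<union> S1"
  shows "(P *v steady_state E w S0 S1) $ v = steady_state E w S0 S1 $ v"
proof -
  let ?L = "laplacian E w"
  define F where "F = UNIV - (S0 \<union> S1)"
  define xS :: "real ^ 'v" where "xS = (\<chi> v. if v \<in> S1 then 1 else 0)"
  define b where "b = block F (S0 \<union> S1) ?L *v xS"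
  define xF where "xF = - (block_inv F ?L *v b)"
  define x where "x = steady_state E w S0 S1"
  have x: "x $ u = (if u \<in> F then xF $ u else xS $ u)" for u
    by (simp add: x_def steady_state_def Let_def F_def xF_def xS_def b_def)
  have "v \<in> F"
    using v by (simp add: F_def)
  have "F \<noteq> UNIV"
    using assms(1) by (auto simp: F_def)
  then have "block F F ?L ** block_inv F ?L = block F F (mat 1)"
    using block_inv_laplacian by (simp add: is_block_inv_def)
  then have "block F F ?L *v xF = - (block F F (mat 1) *v b)"
    by (simp add: xF_def matrix_vector_mul_assoc linear_neg)
  moreover have "(block F F (mat 1) *v b) $ v = b $ v"
    using \<open>v \<in> F\<close>
    by (simp add: block_apply mat_def if_distrib[of "\<lambda>t. t * _"] cong: if_cong)
  ultimately have "(block F F ?L *v xF) $ v + b $ v = 0"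
    by simp
  moreover have "(?L *v x) $ v = (\<Sum>u\<in>F. ?L $ v $ u * x $ u) + (\<Sum>u\<in>S0 \<union> S1. ?L $ v $ u * x $ u)"
    unfolding F_def
    by (simp add: matrix_vector_mult_def sum.subset_diff[of "S0 \<union> S1" UNIV])
  then have "(?L *v x) $ v = (block F F ?L *v xF) $ v + b $ v"
    using \<open>v \<in> F\<close> by (simp add: b_def block_apply x) (simp add: F_def)
  ultimately show ?thesis
    using deg_pos[of v] by (simp add: laplacian_apply x_def)
qed

section \<open>Average opinion in terms of domination scores\<close>

lemma avg_opinion_domination:
  assumes "s0 \<noteq> s1"
  obtains c where "0 \<le> c" "avg_opinion E w {s0} {s1} = c * domination E w s1 s0"
    "1 - avg_opinion E w {s0} {s1} = c * domination E w s0 s1"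
proof -
  define x where "x = steady_state E w {s0} {s1}"
  define y where "y = walk_laplacian E w *v x"
  \<comment> \<open>\<open>y\<close> will be supported on the leaders with zero sum, so this one
    entry determines it.\<close>
  define c where "c = y $ s1"
  let ?X = "pinv (walk_laplacian E w)"
  have x0: "x $ s0 = 0" and x1: "x $ s1 = 1"
    using assms by (simp_all add: x_def steady_state_leader0 steady_state_leader1)
  have harmonic: "(P *v x) $ v = x $ v" if "v \<notin> {s0, s1}" for v
    using that unfolding x_def by (intro steady_state_harmonic) auto
  have y_zero: "y $ v = 0" if "v \<notin> {s0, s1}" for v
    using harmonic[OF that] by (simp add: y_def walk_laplacian_apply)
  have "(\<Sum>v\<in>UNIV. y $ v) = (\<Sum>v\<in>UNIV. (\<Sum>u\<in>UNIV. walk_laplacian E w $ u $ v) * x $ v)"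
    unfolding y_def matrix_vector_mult_def by (simp add: sum_distrib_right) (rule sum.swap)
  then have "(\<Sum>v\<in>UNIV. y $ v) = 0"
    by (simp add: walk_laplacian_column_sum)
  moreover have "(\<Sum>v\<in>UNIV. y $ v) = (\<Sum>v\<in>{s0, s1}. y $ v)"
    using y_zero by (intro sum.mono_neutral_right) auto
  ultimately have y0: "y $ s0 = - c"
    using assms by (simp add: c_def)
  have Xy: "(?X *v y) $ v = c * (?X $ v $ s1 - ?X $ v $ s0)" for v
  proof -
    have "(?X *v y) $ v = (\<Sum>u\<in>{s0, s1}. ?X $ v $ u * y $ u)"
      unfolding matrix_vector_mult_def
      using y_zero by (auto intro!: sum.mono_neutral_right) blast
    then show ?thesis
      using assms y0 by (simp add: c_def[symmetric] algebra_simps)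
  qed
  have deviation: "x $ v - avg_opinion E w {s0} {s1} = c * (?X $ v $ s1 - ?X $ v $ s0)" for v
    using pinv_walk_laplacian_mult[of x v] Xy[of v] by (simp add: y_def avg_opinion_def x_def)
  \<comment> \<open>Opinions are at most 1, so their average under \<open>P\<close> at
    \<open>s1\<close> is at most \<open>x $ s1 = 1\<close>; hence \<open>y $ s1\<close> is
    nonnegative.\<close>
  have "x $ v \<le> 1" for v
    by (rule maximum_principle[of "{s0, s1}" x]) (use harmonic x0 x1 in \<open>auto intro: order_trans[OF _ zero_le_one]\<close>)
  then have "(P *v x) $ s1 \<le> (\<Sum>v\<in>UNIV. P $ s1 $ v)"
    unfolding matrix_vector_mult_def by (simp add: sum_mono mult_left_le nonneg)
  then have "0 \<le> c"
    using stationary_pos[of s1] by (simp add: c_def y_def walk_laplacian_apply x1 row_sum)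
  then show thesis
    using deviation[of s0] deviation[of s1]
    by (intro that[of c]) (simp_all add: domination_def x0 x1 algebra_simps)
qed

end

theorem mainTheorem2:
  fixes E :: "('v::finite \<times> 'v) set"
    and w :: "'v \<Rightarrow> 'v \<Rightarrow> real"
    and \<alpha> :: real
    and s0 s1 :: 'v
  assumes "strongly_connected E"
    and "\<And>u v. (u, v) \<in> E \<Longrightarrow> 0 < w u v"
    and "0 \<le> \<alpha>" and "\<alpha> \<le> 1"
    and "s0 \<noteq> s1"
  shows "opinion_gap E w {s0} {s1} \<alpha> =
    \<bar>(1 - \<alpha>) * domination E w s1 s0 - \<alpha> * domination E w s0 s1\<bar> /
      (domination E w s0 s1 + domination E w s1 s0)"
proof -
  interpret weighted_digraph E w
    using assms by unfold_locales auto
  obtain c where "0 \<le> c"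
    and avg: "avg_opinion E w {s0} {s1} = c * domination E w s1 s0"
      "1 - avg_opinion E w {s0} {s1} = c * domination E w s0 s1"
    by (rule avg_opinion_domination[OF \<open>s0 \<noteq> s1\<close>])
  define D where "D = domination E w s0 s1 + domination E w s1 s0"
  \<comment> \<open>The sum of the two identities. With \<open>0 \<le> c\<close> it makes
    \<open>D\<close> positive, so the absolute value can be taken in the numerator alone.\<close>
  have cD: "c * D = 1"
    using avg by (simp add: D_def algebra_simps)
  then have "D \<noteq> 0" and c: "c = 1 / D"
    by (auto simp: eq_divide_eq)
  with \<open>0 \<le> c\<close> have "0 < D"
    by (simp add: zero_le_divide_1_iff)
  \<comment> \<open>With average \<open>mu\<close>, this is
    \<open>mu - \<alpha> = (1 - \<alpha>) mu - \<alpha> (1 - mu)\<close>.\<close>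
  have "avg_opinion E w {s0} {s1} - \<alpha>
      = ((1 - \<alpha>) * domination E w s1 s0 - \<alpha> * domination E w s0 s1) / D"
    using \<open>D \<noteq> 0\<close> by (simp add: avg c field_simps) (simp add: D_def algebra_simps)
  then show ?thesis
    using \<open>0 < D\<close> by (simp add: opinion_gap_def abs_divide D_def[symmetric])
qed

end
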